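(* Let $\mu$ be a probability measure on $\mathbb{R}^d$ whose mean $m=\int x\,\mathrm{d}\mu$ and covariance matrix $\mathrm{Cov}_\mu$ exist. If a symmetric positive-semidefinite matrix field $W$ is a solution to the optimization problem $$\min_{\substack{W':\mathbb{R}^d\to\mathcal{S}_+^d\\ \int \mathrm{tr}(W')\,\mathrm{d}\mu=\mathrm{tr}(\mathrm{Cov}_\mu)}} C(\mu,W')$$ with $C(\mu,W)=1$, then $W$ is a Stein kernel of $\mu$.
   Context: $\mathcal{S}_+^d\subset\mathbb{R}^{d\times d}$ is the convex cone of symmetric positive-semidefinite matrices. For a probability measure $\mu$ on $\mathbb{R}^d$ and a (measurable) matrix field $W:\mathbb{R}^d\to\mathcal{S}_+^d$, the Poincaré constant $C(\mu,W)\in[0,\infty]$ is the smallest constant such that $$\mathrm{Var}_\mu(f)\le C(\mu,W)\int \nabla f(x)^\top W(x)\nabla f(x)\,\mathrm{d}\mu(x)$$ holds for every sufficiently smooth $f:\mathbb{R}^d\to\mathbb{R}$, understood here as every continuously differentiable $f$ with $\int f^2\,\mathrm{d}\mu<\infty$ and $\int \nabla f^\top W\nabla f\,\mathrm{d}\mu<\infty$; $\mathrm{Var}_\mu(f)=\int (f-\int f\,\mathrm{d}\mu)^2\,\mathrm{d}\mu$. $\mathrm{Cov}_\mu=\int (x-m)(x-m)^\top\,\mathrm{d}\mu(x)$. A Stein kernel of $\mu$ is a matrix field $W:\mathbb{R}^d\to\mathbb{R}^{d\times d}$ (in general not necessarily symmetric or positive-semidefinite) such that $$\int (x-m)f\,\mathrm{d}\mu=\int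 W\nabla f\,\mathrm{d}\mu$$ for any smooth function $f:\mathbb{R}^d\to\mathbb{R}$; for the positive-semidefinite $W$ of the claim, "smooth" means the same class of functions $f$ as in the definition of $C(\mu,W)$ above. *)

theory Defs
  imports "HOL-Probability.Probability"
begin

definition mean_vec :: "(real ^ 'd) measure \<Rightarrow> real ^ 'd" where
  "mean_vec \<mu> = (LINT x|\<mu>. x)"

definition outer :: "real ^ 'd \<Rightarrow> real ^ 'd \<Rightarrow> real ^ 'd ^ 'd" where
  "outer u v = (\<chi> i j. u $ i * v $ j)"

definition cov_mat :: "(real ^ 'd) measure \<Rightarrow> real ^ 'd ^ 'd" where
  "cov_mat \<mu> = (LINT x|\<mu>. outer (x - mean_vec \<mu>) (x - mean_vec \<mu>))"

definition psd :: "real ^ 'd ^ 'd \<Rightarrow> bool" where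
  "psd A \<longleftrightarrow> transpose A = A \<and> (\<forall>v. 0 \<le> v \<bullet> (A *v v))"

definition psd_field :: "(real ^ 'd \<Rightarrow> real ^ 'd ^ 'd) \<Rightarrow> bool" where
  "psd_field W \<longleftrightarrow> W \<in> borel_measurable borel \<and> (\<forall>x. psd (W x))"

definition gradient :: "(real ^ 'd \<Rightarrow> real) \<Rightarrow> real ^ 'd \<Rightarrow> real ^ 'd" where
  "gradient f x = (THE D. GDERIV f x :> D)"

definition cont_diff :: "(real ^ 'd \<Rightarrow> real) \<Rightarrow> bool" where
  "cont_diff f \<longleftrightarrow> (\<forall>x. GDERIV f x :> gradient f x) \<and> continuous_on UNIV (gradient f)"

definition test_functions ::
  "(real ^ 'd) measure \<Rightarrow> (real ^ 'd \<Rightarrow> real ^ 'd ^ 'd) \<Rightarrow> (real ^ 'd \<Rightarrow> real) set" where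
  "test_functions \<mu> W = {f. cont_diff f \<and> integrable \<mu> (\<lambda>x. (f x)\<^sup>2) \<and>
     integrable \<mu> (\<lambda>x. gradient f x \<bullet> (W x *v gradient f x))}"

definition Var :: "(real ^ 'd) measure \<Rightarrow> (real ^ 'd \<Rightarrow> real) \<Rightarrow> real" where
  "Var \<mu> f = (LINT x|\<mu>. (f x - (LINT y|\<mu>. f y))\<^sup>2)"

(* The infimum of the admissible constants in [0,\<infinity>]. If finite, it is itself admissible.
   In ennreal \<infinity> * 0 = 0, so \<infinity> need not belong to the set; the infimum of the empty set is
   \<infinity>, so this does not affect the value. *)
definition poincare_constant ::
  "(real ^ 'd) measure \<Rightarrow> (real ^ 'd \<Rightarrow> real ^ 'd ^ 'd) \<Rightarrow> ennreal" where
  "poincare_constant \<mu> W = Inf {C. \<forall>f \<in> test_functions \<mu> W.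
     ennreal (Var \<mu> f) \<le> C * ennreal (LINT x|\<mu>. gradient f x \<bullet> (W x *v gradient f x))}"

(* The integrability conjunct excludes fields of infinite trace integral, to which the
   Bochner integral assigns the value 0. *)
definition feasible :: "(real ^ 'd) measure \<Rightarrow> (real ^ 'd \<Rightarrow> real ^ 'd ^ 'd) \<Rightarrow> bool" where
  "feasible \<mu> W \<longleftrightarrow> psd_field W \<and> integrable \<mu> (\<lambda>x. trace (W x)) \<and>
     (LINT x|\<mu>. trace (W x)) = trace (cov_mat \<mu>)"

(* Relative to a class F of test functions. W need not be symmetric or positive-semidefinite.
   The existence of both integrals is part of the definition. *)
definition stein_kernel ::
  "(real ^ 'd) measure \<Rightarrow> (real ^ 'd \<Rightarrow> real) set \<Rightarrow> (real ^ 'd \<Rightarrow> real ^ 'd ^ 'd) \<Rightarrow> bool" where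
  "stein_kernel \<mu> F W \<longleftrightarrow> W \<in> borel_measurable borel \<and>
     (\<forall>f \<in> F. integrable \<mu> (\<lambda>x. f x *\<^sub>R (x - mean_vec \<mu>)) \<and>
        integrable \<mu> (\<lambda>x. W x *v gradient f x) \<and>
        (LINT x|\<mu>. f x *\<^sub>R (x - mean_vec \<mu>)) = (LINT x|\<mu>. W x *v gradient f x))"

end

theory Submission
  imports Defs
begin

text \<open>
  Applying the Poincare inequality with constant 1 to the coordinate functions and summing
  gives \<open>tr Cov \<le> \<integral> tr W\<close>, so the trace constraint makes every coordinate function extremal. At
  an extremal function the nonnegative quadratic form \<open>f \<mapsto> \<integral> \<nabla>f \<bullet> W\<nabla>f - Var f\<close> vanishes, hence so
  does its polarization with any test function; this is the Stein identity, coordinate by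
  coordinate.
\<close>

section \<open>Calculus of gradients\<close>

lemma GDERIV_unique: "GDERIV f x :> D \<Longrightarrow> GDERIV f x :> E \<Longrightarrow> D = E"
  unfolding gderiv_def by (drule (1) has_derivative_unique) (metis vector_eq_rdot inner_commute)

text \<open>\<open>gradient\<close> is a definite description, so uniqueness of the derivative is
  what lets any computed derivative be read off as its value.\<close>

lemma gradient_eq: "GDERIV f x :> D \<Longrightarrow> gradient f x = D"
  unfolding gradient_def by (rule the_equality) (auto intro: GDERIV_unique)

lemma cont_diff_inner: "cont_diff (\<lambda>x. x \<bullet> v)"
  and gradient_inner: "gradient (\<lambda>x. x \<bullet> v) = (\<lambda>_. v)"
proof -
  have D: "GDERIV (\<lambda>x. x \<bullet> v) x :> v" for x
    unfolding gderiv_def by (rule bounded_linear_imp_has_derivative) (rule bounded_linear_inner_left)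
  then show G: "gradient (\<lambda>x. x \<bullet> v) = (\<lambda>_. v)"
    by (auto simp: gradient_eq)
  show "cont_diff (\<lambda>x. x \<bullet> v)"
    using D by (simp add: cont_diff_def G)
qed

lemma cont_diff_add_scaled:
  assumes "cont_diff f" "cont_diff g"
  shows "cont_diff (\<lambda>x. f x + t * g x)"
    and "gradient (\<lambda>x. f x + t * g x) = (\<lambda>x. gradient f x + t *\<^sub>R gradient g x)"
proof -
  have D: "GDERIV (\<lambda>x. f x + t * g x) x :> gradient f x + t *\<^sub>R gradient g x" for x
    using GDERIV_add[OF _ GDERIV_mult[OF GDERIV_const, of g x _ t]] assms
    by (fastforce simp: cont_diff_def)
  then show G: "gradient (\<lambda>x. f x + t * g x) = (\<lambda>x. gradient f x + t *\<^sub>R gradient g x)"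
    by (auto simp: gradient_eq)
  show "cont_diff (\<lambda>x. f x + t * g x)"
    using assms D by (auto simp: cont_diff_def G intro!: continuous_intros)
qed

lemma cont_diff_measurable:
  assumes "cont_diff f"
  shows "f \<in> borel_measurable borel" "gradient f \<in> borel_measurable borel"
proof -
  have "continuous_on UNIV f"
    using assms unfolding cont_diff_def gderiv_def
    by (meson continuous_at_imp_continuous_on has_derivative_continuous)
  then show "f \<in> borel_measurable borel" "gradient f \<in> borel_measurable borel"
    using assms by (auto simp: cont_diff_def intro: borel_measurable_continuous_onI)
qed

section \<open>Measurability and integrability of vector-valued maps\<close>

lemma measurable_matrix_vector_mult:
  fixes A :: "'a \<Rightarrow> real ^ 'n ^ 'm" and v :: "'a \<Rightarrow> real ^ 'n"
  assumes "A \<in> borel_measurable M" "v \<in> borel_measurable M"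
  shows "(\<lambda>x. A x *v v x) \<in> borel_measurable M"
  using assms
  by (rule borel_measurable_continuous_Pair)
    (auto simp: matrix_vector_mult_def intro!: continuous_intros)

lemma integrable_vec_componentwise:
  fixes f :: "'a \<Rightarrow> real ^ 'n"
  assumes "\<And>i. integrable M (\<lambda>x. f x $ i)"
  shows "integrable M f"
proof -
  have "f = (\<lambda>x. \<Sum>i\<in>UNIV. (f x $ i) *\<^sub>R axis i 1)"
    by (simp add: basis_expansion flip: scalar_mult_eq_scaleR)
  moreover have "integrable M (\<lambda>x. \<Sum>i\<in>UNIV. (f x $ i) *\<^sub>R (axis i 1 :: real ^ 'n))"
    using assms by (intro Bochner_Integration.integrable_sum integrable_scaleR_left) auto
  ultimately show ?thesis by simp
qed

section \<open>Positive-semidefinite quadratic forms\<close>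

lemma psd_sym: "psd A \<Longrightarrow> u \<bullet> (A *v v) = v \<bullet> (A *v u)"
  by (metis psd_def dot_lmul_matrix vector_transpose_matrix inner_commute)

lemma psd_quadratic_add:
  assumes "psd A"
  shows "(u + t *\<^sub>R v) \<bullet> (A *v (u + t *\<^sub>R v)) =
    u \<bullet> (A *v u) + 2 * t * (u \<bullet> (A *v v)) + t\<^sup>2 * (v \<bullet> (A *v v))"
  using psd_sym[OF assms, of u v]
  by (simp add: matrix_vector_right_distrib matrix_vector_mult_scaleR inner_add_left
      inner_add_right power2_eq_square algebra_simps)

text \<open>Nonnegativity of the form at u + v and at u - v bounds twice the mixed term;
  nonnegativity at u and v allows the factor 2 to be dropped. The bound later supplies an integrable
  majorant for mixed energies.\<close>

lemma psd_bilinear_bound: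
  assumes "psd A"
  shows "\<bar>u \<bullet> (A *v v)\<bar> \<le> u \<bullet> (A *v u) + v \<bullet> (A *v v)"
proof -
  have "0 \<le> w \<bullet> (A *v w)" for w
    using assms by (simp add: psd_def)
  from this[of "u + 1 *\<^sub>R v"] this[of "u + (-1) *\<^sub>R v"] this[of u] this[of v] show ?thesis
    unfolding psd_quadratic_add[OF assms] by simp
qed

text \<open>Diagonal entries are values of the form at basis vectors, hence nonnegative.
  Integrability of the trace therefore passes to each diagonal entry.\<close>

lemma psd_trace_bound:
  assumes "psd A"
  shows "0 \<le> A $ i $ i" "A $ i $ i \<le> trace A"
proof -
  have nn: "0 \<le> A $ j $ j" for j
  proof -
    have "0 \<le> axis j 1 \<bullet> (A *v axis j 1)"
      using assms by (simp add: psd_def)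
    then show ?thesis
      by (simp add: inner_axis' matrix_vector_mult_basis column_def)
  qed
  then show "0 \<le> A $ i $ i" "A $ i $ i \<le> trace A"
    by (auto simp: trace_def intro: member_le_sum)
qed

text \<open>The polynomial vanishes at t = 0, so 0 is a minimum and the first-order term must vanish
  there.\<close>

lemma quadratic_nonneg_linear_coeff:
  fixes b c :: real
  assumes "\<And>t. 0 \<le> 2 * t * b + t\<^sup>2 * c"
  shows "b = 0"
proof (rule ccontr)
  assume "b \<noteq> 0"
  \<comment> \<open>c may be zero or negative, so it is replaced by a positive majorant k. The
    minimum of 2 t b + t^2 k is then at t = - b / k, with value - b^2 / k.\<close>
  define k where "k = \<bar>c\<bar> + 1"
  have k: "k > 0" "c \<le> k" by (auto simp: k_def)
  have "0 \<le> 2 * (- b / k) * b + (- b / k)\<^sup>2 * c"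
    by (rule assms)
  also have "\<dots> \<le> 2 * (- b / k) * b + (- b / k)\<^sup>2 * k"
    using k by (intro add_left_mono mult_left_mono) auto
  also have "\<dots> = - (b\<^sup>2 / k)"
    using k by (simp add: power2_eq_square field_simps)
  also have "\<dots> < 0"
    using k \<open>b \<noteq> 0\<close> by simp
  finally show False by simp
qed

text \<open>The constant is an infimum, so a priori only constants below 1 + e are known to be
  admissible; letting e tend to 0 gives the constant 1 itself. The premise \<open>nn\<close> matters
  because \<open>ennreal\<close> sends negative reals to 0.\<close>

lemma poincare_inequality:
  assumes "poincare_constant \<mu> W = 1" and f: "f \<in> test_functions \<mu> W"
    and nn: "0 \<le> (LINT x|\<mu>. gradient f x \<bullet> (W x *v gradient f x))" (is "0 \<le> ?D")
  shows "Var \<mu> f \<le> (LINT x|\<mu>. gradient f x \<bullet> (W x *v gradient f x))"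
proof -
  have "Var \<mu> f \<le> ?D + ?D * e" if "e > 0" for e
  proof -
    have "poincare_constant \<mu> W < ennreal (1 + e)"
      unfolding assms(1) using that by (simp flip: ennreal_1)
    then obtain C where C: "C < ennreal (1 + e)"
      and "\<forall>f \<in> test_functions \<mu> W. ennreal (Var \<mu> f) \<le>
        C * ennreal (LINT x|\<mu>. gradient f x \<bullet> (W x *v gradient f x))"
      unfolding poincare_constant_def Inf_less_iff by blast
    then have "ennreal (Var \<mu> f) \<le> C * ennreal ?D"
      using f by blast
    also have "\<dots> \<le> ennreal (1 + e) * ennreal ?D"
      using C by (intro mult_right_mono) auto
    also have "\<dots> = ennreal ((1 + e) * ?D)"
      using that nn by (simp add: ennreal_mult)
    finally have "Var \<mu> f \<le> (1 + e) * ?D"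
      by (rule ennreal_le_iff[THEN iffD1, rotated]) (use that nn in simp)
    then show ?thesis
      by (simp add: algebra_simps)
  qed
  note * = this
  show ?thesis
  proof (rule field_le_epsilon)
    fix e :: real assume "e > 0"
    \<comment> \<open>The excess \<open>?D * e\<close> is made small by rescaling e; dividing by
      \<open>?D + 1\<close> instead of \<open>?D\<close> covers the case of zero energy.\<close>
    have "?D * (e / (?D + 1)) \<le> e"
      using \<open>e > 0\<close> nn by (simp add: field_simps)
    with *[of "e / (?D + 1)"] \<open>e > 0\<close> nn show "Var \<mu> f \<le> ?D + e"
      by (simp del: times_divide_eq_right)
  qed
qed

section \<open>Square-integrable functions and variance\<close>

lemma integrable_mult_of_squares:
  fixes f g :: "'a \<Rightarrow> real"
  assumes "f \<in> borel_measurable M" "g \<in> borel_measurable M"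
    and "integrable M (\<lambda>x. (f x)\<^sup>2)" "integrable M (\<lambda>x. (g x)\<^sup>2)"
  shows "integrable M (\<lambda>x. f x * g x)"
proof (rule Bochner_Integration.integrable_bound)
  show "integrable M (\<lambda>x. (f x)\<^sup>2 + (g x)\<^sup>2)"
    using assms by simp
  have "\<bar>a * b\<bar> \<le> a\<^sup>2 + b\<^sup>2" for a b :: real
  proof -
    have "2 * \<bar>a * b\<bar> \<le> a\<^sup>2 + b\<^sup>2"
      using sum_squares_bound[of "\<bar>a\<bar>" "\<bar>b\<bar>"] by (simp add: abs_mult mult.assoc)
    then show ?thesis by linarith
  qed
  then show "AE x in M. norm (f x * g x) \<le> norm ((f x)\<^sup>2 + (g x)\<^sup>2)"
    by simp
qed (use assms in measurable)

lemma (in prob_space) integrable_of_square: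
  fixes f :: "'a \<Rightarrow> real"
  assumes "f \<in> borel_measurable M" "integrable M (\<lambda>x. (f x)\<^sup>2)"
  shows "integrable M f"
  using integrable_mult_of_squares[of f M "\<lambda>_. 1"] assms by simp

text \<open>The linear coefficient is twice the covariance of f and g. Only f is centred in it: a
  centred f integrates to 0 against the mean of g. This is the shape of the left side of the Stein
  identity.\<close>

lemma Var_add_scaled:
  fixes M :: "(real ^ 'd) measure"
  assumes "prob_space M" and "f \<in> borel_measurable M" "g \<in> borel_measurable M"
    and "integrable M (\<lambda>x. (f x)\<^sup>2)" "integrable M (\<lambda>x. (g x)\<^sup>2)"
  shows "Var M (\<lambda>x. f x + t * g x) =
    Var M f + 2 * t * (LINT x|M. (f x - (LINT y|M. f y)) * g x) + t\<^sup>2 * Var M g"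
proof -
  interpret prob_space M by fact
  have [simp]: "integrable M f" "integrable M g" "integrable M (\<lambda>x. f x * g x)"
    using assms by (auto intro: integrable_of_square integrable_mult_of_squares)
  let ?f = "\<lambda>x. f x - (LINT y|M. f y)" and ?g = "\<lambda>x. g x - (LINT y|M. g y)"
  have [simp]: "integrable M (\<lambda>x. (?f x)\<^sup>2)" "integrable M (\<lambda>x. (?g x)\<^sup>2)"
    using assms by (simp_all add: power2_diff)
  have [simp]: "integrable M (\<lambda>x. ?f x * g x)"
    by (simp add: left_diff_distrib)
  have "Var M (\<lambda>x. f x + t * g x) =
    (LINT x|M. (?f x)\<^sup>2 + 2 * t * (?f x * g x - (LINT y|M. g y) * ?f x) + t\<^sup>2 * (?g x)\<^sup>2)"
    unfolding Var_def by (simp add: power2_eq_square algebra_simps)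
  also have "\<dots> = Var M f + 2 * t * ((LINT x|M. ?f x * g x) - (LINT y|M. g y) * (LINT x|M. ?f x))
      + t\<^sup>2 * Var M g"
    \<comment> \<open>Integrals of differences are split only at the cross term, so that the
      integral of the centred function \<open>?f\<close> stays whole and can be evaluated as 0
      next.\<close>
    unfolding Var_def by (simp del: Bochner_Integration.integral_diff
        add: Bochner_Integration.integral_diff[where f="\<lambda>x. ?f x * g x"])
  also have "(LINT x|M. ?f x) = 0"
    by (simp add: prob_space)
  finally show ?thesis by simp
qed

section \<open>The energy form of a fixed positive-semidefinite field\<close>

context
  fixes \<mu> :: "(real ^ 'd) measure" and W :: "real ^ 'd \<Rightarrow> real ^ 'd ^ 'd"
  assumes sets: "sets \<mu> = sets borel" and field: "psd_field W"
begin

lemma test_functionsD: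
  assumes "f \<in> test_functions \<mu> W"
  shows "cont_diff f" "f \<in> borel_measurable \<mu>" "gradient f \<in> borel_measurable \<mu>"
    "integrable \<mu> (\<lambda>x. (f x)\<^sup>2)" "integrable \<mu> (\<lambda>x. gradient f x \<bullet> (W x *v gradient f x))"
  using assms cont_diff_measurable[of f] measurable_cong_sets[OF sets refl]
  by (auto simp: test_functions_def)

lemma measurable_W_gradient:
  assumes "f \<in> test_functions \<mu> W"
  shows "(\<lambda>x. W x *v gradient f x) \<in> borel_measurable \<mu>"
  using test_functionsD[OF assms] field measurable_cong_sets[OF sets refl]
  by (intro measurable_matrix_vector_mult) (auto simp: psd_field_def)

lemma integrable_mixed_energy:
  assumes "f \<in> test_functions \<mu> W" "g \<in> test_functions \<mu> W"
  shows "integrable \<mu> (\<lambda>x. gradient f x \<bullet> (W x *v gradient g x))"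
proof (rule Bochner_Integration.integrable_bound)
  show "integrable \<mu> (\<lambda>x. gradient f x \<bullet> (W x *v gradient f x) + gradient g x \<bullet> (W x *v gradient g x))"
    using test_functionsD[OF assms(1)] test_functionsD[OF assms(2)] by simp
  show "(\<lambda>x. gradient f x \<bullet> (W x *v gradient g x)) \<in> borel_measurable \<mu>"
    by (intro borel_measurable_inner test_functionsD[OF assms(1)] measurable_W_gradient[OF assms(2)])
  have "psd (W x)" for x
    using field by (simp add: psd_field_def)
  then show "AE x in \<mu>. norm (gradient f x \<bullet> (W x *v gradient g x)) \<le>
      norm (gradient f x \<bullet> (W x *v gradient f x) + gradient g x \<bullet> (W x *v gradient g x))"
    unfolding real_norm_def by (intro AE_I2 order_trans[OF psd_bilinear_bound abs_ge_self])
qed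

text \<open>The variational argument applies the Poincare inequality along the line f + t g, so this
  line must stay in the test class and its energy must be an explicit quadratic in t.\<close>

lemma test_functions_add_scaled:
  assumes f: "f \<in> test_functions \<mu> W" and g: "g \<in> test_functions \<mu> W"
  shows "(\<lambda>x. f x + t * g x) \<in> test_functions \<mu> W"
    and "(LINT x|\<mu>. gradient (\<lambda>x. f x + t * g x) x \<bullet>
        (W x *v gradient (\<lambda>x. f x + t * g x) x)) =
      (LINT x|\<mu>. gradient f x \<bullet> (W x *v gradient f x)) +
      2 * t * (LINT x|\<mu>. gradient f x \<bullet> (W x *v gradient g x)) +
      t\<^sup>2 * (LINT x|\<mu>. gradient g x \<bullet> (W x *v gradient g x))"
proof -
  let ?h = "\<lambda>x. f x + t * g x"
  note F = test_functionsD[OF f] and G = test_functionsD[OF g]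
  have psd: "psd (W x)" for x
    using field by (simp add: psd_field_def)
  note E = integrable_mixed_energy[OF f g]
  have grad: "gradient ?h x \<bullet> (W x *v gradient ?h x) =
      gradient f x \<bullet> (W x *v gradient f x) + 2 * t * (gradient f x \<bullet> (W x *v gradient g x)) +
      t\<^sup>2 * (gradient g x \<bullet> (W x *v gradient g x))" for x
    unfolding cont_diff_add_scaled(2)[OF F(1) G(1)] by (rule psd_quadratic_add[OF psd])
  have "(?h x)\<^sup>2 = (f x)\<^sup>2 + 2 * t * (f x * g x) + t\<^sup>2 * (g x)\<^sup>2" for x
    by (simp add: power2_eq_square algebra_simps)
  then have "integrable \<mu> (\<lambda>x. (?h x)\<^sup>2)"
    using F G integrable_mult_of_squares[OF F(2) G(2) F(4) G(4)] by simp
  then show "?h \<in> test_functions \<mu> W"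
    using cont_diff_add_scaled(1)[OF F(1) G(1)] F(5) G(5) E
    unfolding test_functions_def by (simp add: grad)
  show "(LINT x|\<mu>. gradient ?h x \<bullet> (W x *v gradient ?h x)) =
      (LINT x|\<mu>. gradient f x \<bullet> (W x *v gradient f x)) +
      2 * t * (LINT x|\<mu>. gradient f x \<bullet> (W x *v gradient g x)) +
      t\<^sup>2 * (LINT x|\<mu>. gradient g x \<bullet> (W x *v gradient g x))"
    unfolding grad using F(5) G(5) E by simp
qed

lemma energy_nonneg: "0 \<le> (LINT x|\<mu>. gradient f x \<bullet> (W x *v gradient f x))"
  using field by (intro integral_nonneg_AE AE_I2) (simp add: psd_field_def psd_def)

text \<open>Energy minus variance of f + t g is a quadratic in t that is nonnegative by the Poincare
  inequality and zero at t = 0 by extremality of f. Its linear coefficient, twice the difference of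
  the two sides, is therefore 0.\<close>

lemma extremal_polarization:
  assumes "prob_space \<mu>" and "poincare_constant \<mu> W = 1"
    and f: "f \<in> test_functions \<mu> W" and g: "g \<in> test_functions \<mu> W"
    and extremal: "Var \<mu> f = (LINT x|\<mu>. gradient f x \<bullet> (W x *v gradient f x))"
  shows "(LINT x|\<mu>. (f x - (LINT y|\<mu>. f y)) * g x) = (LINT x|\<mu>. gradient f x \<bullet> (W x *v gradient g x))"
    (is "?C = ?E")
proof -
  interpret prob_space \<mu> by fact
  note F = test_functionsD[OF f] and G = test_functionsD[OF g]
  have "0 \<le> 2 * t * (?E - ?C)
    + t\<^sup>2 * ((LINT x|\<mu>. gradient g x \<bullet> (W x *v gradient g x)) - Var \<mu> g)" for t
    using poincare_inequality[OF assms(2) test_functions_add_scaled(1)[OF f g, of t] energy_nonneg]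
    unfolding test_functions_add_scaled(2)[OF f g] Var_add_scaled[OF assms(1) F(2) G(2) F(4) G(4)] extremal
    by (simp add: algebra_simps)
  then have "?E - ?C = 0"
    by (rule quadratic_nonneg_linear_coeff)
  then show ?thesis by simp
qed

end

theorem theorem3p2:
  fixes \<mu> :: "(real ^ 'd) measure" and W :: "real ^ 'd \<Rightarrow> real ^ 'd ^ 'd"
  assumes "prob_space \<mu>" and "sets \<mu> = sets borel"
    and "integrable \<mu> (\<lambda>x. x)"
    and "integrable \<mu> (\<lambda>x. outer (x - mean_vec \<mu>) (x - mean_vec \<mu>))"
    and "is_arg_min (poincare_constant \<mu>) (feasible \<mu>) W"
    and "poincare_constant \<mu> W = 1"
  shows "stein_kernel \<mu> (test_functions \<mu> W) W"
proof -
  interpret prob_space \<mu> by fact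
  have feas: "psd_field W" "integrable \<mu> (\<lambda>x. trace (W x))"
      "(LINT x|\<mu>. trace (W x)) = trace (cov_mat \<mu>)"
    using assms(5) by (auto simp: is_arg_min_def feasible_def)
  have psd: "psd (W x)" and Wm: "W \<in> borel_measurable borel" for x
    using feas(1) by (auto simp: psd_field_def)
  note meas_eq = measurable_cong_sets[OF assms(2) refl]
  let ?m = "mean_vec \<mu>"
  have mean: "(LINT x|\<mu>. x $ i) = ?m $ i" and int_coord: "integrable \<mu> (\<lambda>x. x $ i)" for i
    using integral_bounded_linear[OF bounded_linear_vec_nth assms(3)]
      integrable_bounded_linear[OF bounded_linear_vec_nth assms(3)]
    by (auto simp: mean_vec_def)
  have outer_nth: "outer (x - ?m) (x - ?m) $ i $ i = (x $ i - ?m $ i)\<^sup>2" for x :: "real ^ 'd" and i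
    by (simp add: outer_def power2_eq_square)
  have int_sq: "integrable \<mu> (\<lambda>x. (x $ i - ?m $ i)\<^sup>2)" for i
    using integrable_bounded_linear[OF bounded_linear_vec_nth
        integrable_bounded_linear[OF bounded_linear_vec_nth assms(4)], of i i]
    by (simp add: outer_nth)
  have cov: "cov_mat \<mu> $ i $ i = Var \<mu> (\<lambda>x. x $ i)" for i
    using integral_bounded_linear[OF bounded_linear_vec_nth assms(4), of i]
      integral_bounded_linear[OF bounded_linear_vec_nth
        integrable_bounded_linear[OF bounded_linear_vec_nth assms(4)], of i i]
    by (simp add: cov_mat_def Var_def outer_nth mean)
  have W_diag: "axis i 1 \<bullet> (W x *v axis i 1) = W x $ i $ i" for x i
    by (simp add: inner_axis' matrix_vector_mult_basis column_def)
  have int_diag: "integrable \<mu> (\<lambda>x. W x $ i $ i)" for i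
  proof (rule Bochner_Integration.integrable_bound[OF feas(2)])
    have "(\<lambda>A :: real ^ 'd ^ 'd. A $ i $ i) \<in> borel_measurable borel"
      by (intro borel_measurable_continuous_onI continuous_intros)
    from measurable_compose[OF Wm this] show "(\<lambda>x. W x $ i $ i) \<in> borel_measurable \<mu>"
      by (simp add: meas_eq)
    have "norm (W x $ i $ i) \<le> norm (trace (W x))" for x
      using psd_trace_bound[OF psd, of x i] by simp
    then show "AE x in \<mu>. norm (W x $ i $ i) \<le> norm (trace (W x))"
      by simp
  qed
  have coord_inner: "(\<lambda>x :: real ^ 'd. x $ i) = (\<lambda>x. x \<bullet> axis i 1)" for i
    by (simp add: inner_axis)
  have grad_coord: "gradient (\<lambda>x :: real ^ 'd. x $ i) = (\<lambda>_. axis i 1)" for i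
    unfolding coord_inner by (rule gradient_inner)
  have coord: "(\<lambda>x. x $ i) \<in> test_functions \<mu> W" for i
  proof -
    \<comment> \<open>The covariance hypothesis controls centred squares, whereas the test class
      asks for uncentred ones; the existing mean bridges the two.\<close>
    have "(\<lambda>x. (x $ i)\<^sup>2) = (\<lambda>x. (x $ i - ?m $ i)\<^sup>2 + 2 * ?m $ i * x $ i - (?m $ i)\<^sup>2)"
      by (simp add: fun_eq_iff power2_eq_square algebra_simps)
    moreover have "integrable \<mu> (\<lambda>x. (x $ i - ?m $ i)\<^sup>2 + 2 * ?m $ i * x $ i - (?m $ i)\<^sup>2)"
      using int_sq int_coord by simp
    ultimately have "integrable \<mu> (\<lambda>x. (x $ i)\<^sup>2)"
      by simp
    moreover have "cont_diff (\<lambda>x :: real ^ 'd. x $ i)"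
      unfolding coord_inner by (rule cont_diff_inner)
    ultimately show ?thesis
      unfolding test_functions_def by (simp add: grad_coord W_diag int_diag)
  qed
  have le: "Var \<mu> (\<lambda>x. x $ i) \<le> (LINT x|\<mu>. W x $ i $ i)" for i
    using poincare_inequality[OF assms(6) coord energy_nonneg[OF assms(2) feas(1)], of i]
    by (simp add: grad_coord W_diag)
  \<comment> \<open>The gaps in \<open>le\<close> are nonnegative and, by the trace constraint, sum
    to zero; hence each of them vanishes.\<close>
  have "(\<Sum>i\<in>UNIV. (LINT x|\<mu>. W x $ i $ i) - Var \<mu> (\<lambda>x. x $ i)) = 0"
    using feas(3) int_diag by (simp add: trace_def cov sum_subtractf)
  then have "Var \<mu> (\<lambda>x. x $ i) = (LINT x|\<mu>. W x $ i $ i)" for i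
    using le by (subst (asm) sum_nonneg_eq_0_iff) (auto simp: le_diff_eq)
  then have extremal: "Var \<mu> (\<lambda>x. x $ i) =
      (LINT x|\<mu>. gradient (\<lambda>x. x $ i) x \<bullet> (W x *v gradient (\<lambda>x. x $ i) x))" for i
    by (simp add: grad_coord W_diag)
  show ?thesis
    unfolding stein_kernel_def
  proof (intro conjI ballI Wm)
    fix f assume f: "f \<in> test_functions \<mu> W"
    note F = test_functionsD[OF assms(2) feas(1) f]
    have coord_meas: "(\<lambda>x. x $ i - ?m $ i) \<in> borel_measurable \<mu>" for i
      using int_coord[of i] by measurable
    have int1: "integrable \<mu> (\<lambda>x. (f x *\<^sub>R (x - ?m)) $ i)" for i
      using integrable_mult_of_squares[OF F(2) coord_meas F(4) int_sq, of i] by simp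
    then show I1: "integrable \<mu> (\<lambda>x. f x *\<^sub>R (x - ?m))"
      by (rule integrable_vec_componentwise)
    \<comment> \<open>Component i of W applied to the gradient of f is the mixed energy density of
      the i-th coordinate function and f, since that coordinate has gradient
      \<open>axis i 1\<close>.\<close>
    have int2: "integrable \<mu> (\<lambda>x. (W x *v gradient f x) $ i)" for i
      using integrable_mixed_energy[OF assms(2) feas(1) coord f, of i]
      by (simp add: grad_coord inner_axis')
    then show I2: "integrable \<mu> (\<lambda>x. W x *v gradient f x)"
      by (rule integrable_vec_componentwise)
    \<comment> \<open>Polarization at the i-th coordinate function, whose mean is component i of
      \<open>?m\<close>, is exactly component i of the Stein identity.\<close>
    have "(LINT x|\<mu>. f x *\<^sub>R (x - ?m)) $ i = (LINT x|\<mu>. W x *v gradient f x) $ i" for i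
      using extremal_polarization[OF assms(2) feas(1) assms(1) assms(6) coord f extremal, of i]
        integral_bounded_linear[OF bounded_linear_vec_nth I1, of i]
        integral_bounded_linear[OF bounded_linear_vec_nth I2, of i]
      by (simp add: grad_coord inner_axis' mean mult.commute)
    then show "(LINT x|\<mu>. f x *\<^sub>R (x - ?m)) = (LINT x|\<mu>. W x *v gradient f x)"
      by (simp add: vec_eq_iff)
  qed
qed

end
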